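(* Let $r\ge 2$ be an integer, $c=2^{r+1}$ and $d=8r$. Then asymptotically almost surely $\mathcal{G}(cn,cn,d/n)\to(P_n)_r$. Consequently $\hat{R}(P_n,r)<33\,r\,4^r\,n$ for all sufficiently large $n$.
   Context: $\mathcal{G}(N,N,p)$ is the binomial random bipartite graph with two parts of size $N$ in which each pair with one vertex in each part is an edge independently with probability $p$. $P_n$ is the path on $n$ vertices; $G\to(P_n)_r$ means every colouring of the edges of $G$ with $r$ colours yields a monochromatic copy of $P_n$; $\hat{R}(P_n,r)=\min\{|E(G)|:G\to(P_n)_r\}$. Asymptotically almost surely (a.a.s.) means with probability tending to $1$ as $n\to\infty$. *)

theory Defs
  imports "HOL-Probability.Probability" "HOL-Library.Extended_Nat"
begin

record 'a ugraph =
  verts :: "'a set"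
  edges :: "'a set set"

definition simple_graph :: "'a ugraph \<Rightarrow> bool" where
  "simple_graph G \<longleftrightarrow> finite (verts G) \<and> edges G \<subseteq> {e. e \<subseteq> verts G \<and> card e = 2}"

definition path_graph :: "nat \<Rightarrow> nat ugraph" where
  "path_graph n = \<lparr>verts = {..<n}, edges = {{i, Suc i} |i. Suc i < n}\<rparr>"

text \<open>A copy is a not necessarily induced subgraph.\<close>

definition contains_copy :: "'a ugraph \<Rightarrow> 'b ugraph \<Rightarrow> bool" where
  "contains_copy G H \<longleftrightarrow>
     (\<exists>f. inj_on f (verts H) \<and> f ` verts H \<subseteq> verts G \<and> (\<forall>e\<in>edges H. f ` e \<in> edges G))"

definition colour_class :: "'a ugraph \<Rightarrow> ('a set \<Rightarrow> nat) \<Rightarrow> nat \<Rightarrow> 'a ugraph" where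
  "colour_class G col k = \<lparr>verts = verts G, edges = {e \<in> edges G. col e = k}\<rparr>"

definition ramsey_arrow :: "'a ugraph \<Rightarrow> 'b ugraph \<Rightarrow> nat \<Rightarrow> bool" where
  "ramsey_arrow G H r \<longleftrightarrow>
     (\<forall>col \<in> edges G \<rightarrow> {..<r}. \<exists>k<r. contains_copy (colour_class G col k) H)"

text \<open>
  Every finite graph is isomorphic to one whose vertices are natural numbers, so the infimum
  ranges over all finite graphs up to isomorphism.  It is taken in \<^typ>\<open>enat\<close>, where the
  infimum of the empty set is \<open>\<infinity>\<close>; an upper bound therefore asserts that some \<open>G\<close> exists.
\<close>

definition size_ramsey :: "'b ugraph \<Rightarrow> nat \<Rightarrow> enat" where
  "size_ramsey H r =
     Inf {enat (card (edges G)) |G :: nat ugraph. simple_graph G \<and> ramsey_arrow G H r}"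

text \<open>
  The binomial random bipartite graph with parts \<open>{..<M}\<close> and \<open>{M..<M + N}\<close>.  The potential
  edges are indexed by \<open>{..<M} \<times> {..<N}\<close>, with \<open>(i, j)\<close> standing for the edge \<open>{i, M + j}\<close>.
  Since \<^const>\<open>bernoulli_pmf\<close> truncates its parameter to the unit interval, this is defined for
  all real \<open>p\<close> but is only meaningful for \<open>0 \<le> p \<le> 1\<close>.
\<close>

definition random_bipartite :: "nat \<Rightarrow> nat \<Rightarrow> real \<Rightarrow> nat ugraph pmf" where
  "random_bipartite M N p =
     map_pmf
       (\<lambda>X. \<lparr>verts = {..<M + N}, edges = {{i, M + j} |i j. i < M \<and> j < N \<and> X (i, j)}\<rparr>)
       (Pi_pmf ({..<M} \<times> {..<N}) False (\<lambda>_. bernoulli_pmf p))"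

end

theory Submission
  imports Defs
begin

text \<open>
  Depth-first search in a graph without a path on \<open>n\<close> vertices leaves two large sets with no
  edges between them: the finished vertices are never adjacent to the unvisited ones, and the
  stack is a path, hence short.  Doing this for one colour after the other halves the sets \<open>r\<close>
  times, so that a colouring of a bipartite graph with parts of size \<open>2 ^ (r + 1) * n\<close> without
  monochromatic \<open>P\<^sub>n\<close> yields two sets of size \<open>n\<close> with no edge of the graph between them.
  A union bound excludes such sets in the random graph.  For the size Ramsey number, the
  expected number of edges is \<open>32 r 4\<^sup>r n\<close>, so Markov's inequality leaves probability at least
  \<open>1/33\<close> for having fewer than \<open>33 r 4\<^sup>r n\<close> edges.
\<close>

section \<open>Depth-first search: two large sets without edges between them\<close>

text \<open>The search stops once \<open>k\<close> vertices of \<open>A\<close> or \<open>k\<close>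
  vertices of \<open>B\<close> are finished. On the opposite side at most \<open>k\<close> vertices
  are then finished and fewer than \<open>n\<close> lie on the stack, so out of
  \<open>2 * k + n\<close> vertices at least \<open>k\<close> are unvisited.\<close>

lemma dfs_split:
  fixes E :: "'a \<Rightarrow> 'a \<Rightarrow> bool"
  assumes fin: "finite A" "finite B" and disj: "A \<inter> B = {}" and sym: "symp E"
    and card: "2 * k + n \<le> card A" "2 * k + n \<le> card B"
    and no_path: "\<And>xs. \<lbrakk>distinct xs; set xs \<subseteq> A \<union> B; successively E xs\<rbrakk> \<Longrightarrow> length xs \<noteq> n"
  shows "\<exists>S T. S \<subseteq> A \<and> T \<subseteq> B \<and> k \<le> card S \<and> k \<le> card T \<and> (\<forall>s\<in>S. \<forall>t\<in>T. \<not> E s t)"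
    (is ?goal)
proof -
  \<comment> \<open>\<open>no_path\<close> forbids exactly \<open>n\<close> vertices; a longer path
    is excluded through its first \<open>n\<close> vertices.\<close>
  have short: "length xs < n"
    if "distinct xs" "set xs \<subseteq> A \<union> B" "successively E xs" for xs
  proof (rule ccontr)
    assume "\<not> length xs < n"
    moreover have "successively E (take n xs)"
      using that(3) successively_append_iff[of E "take n xs" "drop n xs"] by simp
    ultimately show False
      using no_path[of "take n xs"] that set_take_subset[of n xs] by auto
  qed
  \<comment> \<open>\<open>D\<close> are the finished, \<open>U\<close> the unvisited vertices, \<open>xs\<close> is the stack\<close>
  have step: ?goal
    if "distinct xs" "D \<union> set xs \<union> U = A \<union> B" "D \<inter> set xs = {}" "D \<inter> U = {}"
      "set xs \<inter> U = {}" "successively E xs" "\<And>x y. x \<in> D \<Longrightarrow> y \<in> U \<Longrightarrow> \<not> E x y"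
      "card (D \<inter> A) \<le> k" "card (D \<inter> B) \<le> k" for D xs U
    using that
  \<comment> \<open>Pushing moves a vertex from \<open>U\<close> to the stack, popping shortens the
    stack; the weight 2 on \<open>U\<close> makes the measure drop by 1 in both cases.\<close>
  proof (induction "2 * card U + length xs" arbitrary: D xs U rule: less_induct)
    case less
    have finU: "finite U" and finD: "finite D"
      using less.prems(2) fin by (metis finite_Un)+
    have len: "length xs < n"
      using short less.prems(1,2,6) by blast
    have large: "k \<le> card (U \<inter> C)"
      if C: "C \<subseteq> A \<union> B" "2 * k + n \<le> card C" "card (D \<inter> C) \<le> k" for C
    proof -
      have "C = D \<inter> C \<union> (set xs \<inter> C \<union> U \<inter> C)"
        using C(1) less.prems(2) by blast
      then have "card C \<le> card (D \<inter> C) + card (set xs \<inter> C \<union> U \<inter> C)"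
        using card_Un_le[of "D \<inter> C" "set xs \<inter> C \<union> U \<inter> C"] by simp
      moreover have "card (set xs \<inter> C \<union> U \<inter> C) \<le> card (set xs \<inter> C) + card (U \<inter> C)"
        by (rule card_Un_le)
      moreover have "card (set xs \<inter> C) \<le> length xs"
        by (rule le_trans[OF card_mono card_length]) auto
      ultimately show ?thesis
        using C len by linarith
    qed
    show ?case
    \<comment> \<open>The finished vertices of the side that has reached \<open>k\<close> are paired
      with the unvisited vertices of the other side.\<close>
    proof (cases "card (D \<inter> A) = k \<or> card (D \<inter> B) = k")
      case True
      then show ?thesis
      proof
        assume "card (D \<inter> A) = k"
        moreover have "k \<le> card (U \<inter> B)"
          using large[of B] card less.prems(9) by simp
        ultimately show ?thesis
          using less.prems(7) by (intro exI[of _ "D \<inter> A"] exI[of _ "U \<inter> B"]) auto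
      next
        assume "card (D \<inter> B) = k"
        moreover have "k \<le> card (U \<inter> A)"
          using large[of A] card less.prems(8) by simp
        ultimately show ?thesis
          using less.prems(7) sympD[OF sym]
          by (intro exI[of _ "U \<inter> A"] exI[of _ "D \<inter> B"]) auto
      qed
    next
      case False
      then have lt: "card (D \<inter> A) < k" "card (D \<inter> B) < k"
        using less.prems(8,9) by auto
      show ?thesis
      proof (cases xs)
        case Nil
        \<comment> \<open>With an empty stack the search restarts at an unvisited vertex, which
          exists because \<open>k\<close> is positive here.\<close>
        have "U \<noteq> {}"
          using large[of A] card less.prems(8) lt(1) by auto
        then obtain u where u: "u \<in> U"
          by blast
        then have "card U = Suc (card (U - {u}))"
          using finU by (metis card_Suc_Diff1)
        show ?thesis
        proof (rule less.hyps)
          show "2 * card (U - {u}) + length [u] < 2 * card U + length xs"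
            using \<open>card U = _\<close> by simp
          show "D \<union> set [u] \<union> (U - {u}) = A \<union> B"
            unfolding less.prems(2)[symmetric] using u Nil by auto
          show "D \<inter> set [u] = {}" "D \<inter> (U - {u}) = {}"
            using u less.prems(4) by auto
          show "\<not> E x y" if "x \<in> D" "y \<in> U - {u}" for x y
            using that less.prems(7) by blast
        qed (use less.prems(8,9) in simp_all)
      next
        case (Cons v ys)
        show ?thesis
        proof (cases "\<exists>u\<in>U. E u v")
          case True
          then obtain u where u: "u \<in> U" "E u v"
            by blast
          then have "card U = Suc (card (U - {u}))"
            using finU by (metis card_Suc_Diff1)
          show ?thesis
          proof (rule less.hyps)
            show "2 * card (U - {u}) + length (u # xs) < 2 * card U + length xs"
              using \<open>card U = _\<close> by simp
            show "distinct (u # xs)"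
              using less.prems(1,5) u(1) by auto
            show "D \<union> set (u # xs) \<union> (U - {u}) = A \<union> B"
              unfolding less.prems(2)[symmetric] using u(1) by auto
            show "D \<inter> set (u # xs) = {}" "D \<inter> (U - {u}) = {}" "set (u # xs) \<inter> (U - {u}) = {}"
              using u(1) less.prems(3,4,5) by auto
            show "successively E (u # xs)"
              using u(2) less.prems(6) Cons by simp
            show "\<not> E x y" if "x \<in> D" "y \<in> U - {u}" for x y
              using that less.prems(7) by blast
          qed (fact less.prems(8,9))+
        next
          case False
          \<comment> \<open>The top \<open>v\<close> has no unvisited neighbour, so it may be
            finished. Both counts are still below \<open>k\<close>, so one more vertex respects both
            bounds.\<close>
          have "card (insert v D \<inter> C) \<le> Suc (card (D \<inter> C))" for C
            using finD by (simp add: Int_insert_left card_insert_if)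
          then have "card (insert v D \<inter> A) \<le> k" "card (insert v D \<inter> B) \<le> k"
            using lt by (meson Suc_leI le_trans)+
          note card_insert = this
          show ?thesis
          proof (rule less.hyps)
            show "2 * card U + length ys < 2 * card U + length xs" "distinct ys"
              using less.prems(1) Cons by simp_all
            show "insert v D \<union> set ys \<union> U = A \<union> B"
              unfolding less.prems(2)[symmetric] using Cons by auto
            show "insert v D \<inter> set ys = {}" "insert v D \<inter> U = {}" "set ys \<inter> U = {}"
              using less.prems(1,3,4,5) Cons by auto
            show "successively E ys"
              using less.prems(6) Cons by (auto simp: successively_Cons)
            show "\<not> E x y" if "x \<in> insert v D" "y \<in> U" for x y
              using that less.prems(7) False sympD[OF sym] by blast
          qed (fact card_insert)+
        qed
      qed
    qed
  qed
  show ?thesis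
    by (rule step[of "[]" "{}" "A \<union> B"]) auto
qed

section \<open>From the absence of holes to the Ramsey property\<close>

lemma contains_copy_pathI:
  assumes "distinct xs" "set xs \<subseteq> verts G" "successively (\<lambda>x y. {x, y} \<in> edges G) xs"
  shows "contains_copy G (path_graph (length xs))"
  unfolding contains_copy_def
proof (intro exI conjI)
  show "inj_on ((!) xs) (verts (path_graph (length xs)))"
    using assms(1) by (auto simp: path_graph_def inj_on_def nth_eq_iff_index_eq)
  show "(!) xs ` verts (path_graph (length xs)) \<subseteq> verts G"
    using assms(2) by (auto simp: path_graph_def)
  have "{xs ! i, xs ! Suc i} \<in> edges G" if "Suc i < length xs" for i
    using assms(3) that by (simp add: successively_conv_nth)
  then show "\<forall>e\<in>edges (path_graph (length xs)). (!) xs ` e \<in> edges G"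
    by (auto simp: path_graph_def)
qed

text \<open>This disposes of all colourings deterministically: the probability estimate only has to
  exclude pairs of \<open>n\<close>-sets with no edge between them.\<close>

lemma ramsey_arrow_path_if_no_hole:
  assumes fin: "finite A" "finite B" and disj: "A \<inter> B = {}" and verts: "A \<union> B \<subseteq> verts G"
    and card: "card A = 2 ^ (r + 1) * n" "card B = 2 ^ (r + 1) * n"
    and no_hole: "\<And>S T. \<lbrakk>S \<subseteq> A; T \<subseteq> B; card S = n; card T = n\<rbrakk>
      \<Longrightarrow> \<exists>s\<in>S. \<exists>t\<in>T. {s, t} \<in> edges G"
  shows "ramsey_arrow G (path_graph n) r"
  unfolding ramsey_arrow_def
proof (rule ballI, rule ccontr)
  fix col
  assume col: "col \<in> edges G \<rightarrow> {..<r}"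
    and "\<not> (\<exists>k<r. contains_copy (colour_class G col k) (path_graph n))"
  then have no_copy: "\<not> contains_copy (colour_class G col k) (path_graph n)" if "k < r" for k
    using that by blast
  \<comment> \<open>After \<open>j\<close> rounds the colours below \<open>j\<close> no longer occur
    between \<open>S\<close> and \<open>T\<close>. The sizes
    \<open>s j = (2 ^ (r + 1 - j) - 1) * n\<close> solve \<open>s j = 2 * s (j + 1) + n\<close>, the
    loss in \<open>dfs_split\<close>, with \<open>s r = n\<close>.\<close>
  have split: "\<exists>S T. S \<subseteq> A \<and> T \<subseteq> B \<and> (2 ^ (r + 1 - j) - 1) * n \<le> card S \<and>
      (2 ^ (r + 1 - j) - 1) * n \<le> card T \<and>
      (\<forall>s\<in>S. \<forall>t\<in>T. {s, t} \<in> edges G \<longrightarrow> j \<le> col {s, t})" if "j \<le> r" for j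
    using that
  proof (induction j)
    case 0
    show ?case
      using card by (intro exI[of _ A] exI[of _ B]) auto
  next
    case (Suc j)
    then obtain S T where ST: "S \<subseteq> A" "T \<subseteq> B" "(2 ^ (r + 1 - j) - 1) * n \<le> card S"
      "(2 ^ (r + 1 - j) - 1) * n \<le> card T"
      "\<And>s t. s \<in> S \<Longrightarrow> t \<in> T \<Longrightarrow> {s, t} \<in> edges G \<Longrightarrow> j \<le> col {s, t}"
      by (metis Suc_leD)
    define E where "E x y \<longleftrightarrow> {x, y} \<in> edges (colour_class G col j)" for x y
    define k where "k = (2 ^ (r + 1 - Suc j) - 1) * n"
    have "2 ^ (r + 1 - j) - 1 = 2 * (2 ^ (r + 1 - Suc j) - 1) + (1::nat)"
    proof -
      have "r + 1 - j = Suc (r + 1 - Suc j)"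
        using Suc.prems by auto
      then have "2 ^ (r + 1 - j) = 2 * (2::nat) ^ (r + 1 - Suc j)"
        by simp
      moreover have "(1::nat) \<le> 2 ^ (r + 1 - Suc j)"
        by simp
      ultimately show ?thesis
        by linarith
    qed
    then have k: "2 * k + n = (2 ^ (r + 1 - j) - 1) * n"
      unfolding k_def by (simp only: add_mult_distrib mult.assoc mult_1)
    have "\<exists>S' T'. S' \<subseteq> S \<and> T' \<subseteq> T \<and> k \<le> card S' \<and> k \<le> card T' \<and> (\<forall>s\<in>S'. \<forall>t\<in>T'. \<not> E s t)"
    proof (rule dfs_split)
      show "finite S" "finite T" "S \<inter> T = {}"
        using ST(1,2) fin disj finite_subset by blast+
      show "symp E"
        by (auto simp: symp_def E_def insert_commute)
      show "2 * k + n \<le> card S" "2 * k + n \<le> card T"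
        using ST(3,4) k by simp_all
      fix xs assume xs: "distinct xs" "set xs \<subseteq> S \<union> T" "successively E xs"
      have "contains_copy (colour_class G col j) (path_graph (length xs))"
      proof (rule contains_copy_pathI)
        show "set xs \<subseteq> verts (colour_class G col j)"
          using xs(2) ST(1,2) verts unfolding colour_class_def by simp blast
      qed (use xs in \<open>simp_all add: E_def[abs_def]\<close>)
      then show "length xs \<noteq> n"
        using no_copy[of j] Suc.prems by auto
    qed
    then obtain S' T' where S'T': "S' \<subseteq> S" "T' \<subseteq> T" "k \<le> card S'" "k \<le> card T'"
      "\<And>s t. s \<in> S' \<Longrightarrow> t \<in> T' \<Longrightarrow> \<not> E s t"
      by blast
    have "Suc j \<le> col {s, t}" if "s \<in> S'" "t \<in> T'" "{s, t} \<in> edges G" for s t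
    proof -
      have "j \<le> col {s, t}" "col {s, t} \<noteq> j"
        using that ST(5) S'T' by (auto simp: E_def colour_class_def)
      then show ?thesis
        by simp
    qed
    then show ?case
      using S'T' ST(1,2) by (intro exI[of _ S'] exI[of _ T']) (auto simp: k_def)
  qed
  \<comment> \<open>At \<open>j = r\<close> no colour is left, so no edge of \<open>G\<close> joins
    \<open>S\<close> and \<open>T\<close>; subsets of size exactly \<open>n\<close> then contradict
    \<open>no_hole\<close>.\<close>
  obtain S T where ST: "S \<subseteq> A" "T \<subseteq> B" "n \<le> card S" "n \<le> card T"
    "\<And>s t. s \<in> S \<Longrightarrow> t \<in> T \<Longrightarrow> {s, t} \<in> edges G \<Longrightarrow> r \<le> col {s, t}"
    using split[of r] by auto
  obtain S' T' where "S' \<subseteq> S" "card S' = n" "T' \<subseteq> T" "card T' = n"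
    using ST(3,4) by (meson obtain_subset_with_card_n)
  then obtain s t where "s \<in> S" "t \<in> T" "{s, t} \<in> edges G"
    using no_hole[of S' T'] ST(1,2) by blast
  then show False
    using ST(5)[of s t] funcset_mem[OF col, of "{s, t}"] by simp
qed

section \<open>Bounds for binomial coefficients\<close>

lemma exp_ge_power_div_fact:
  fixes x :: real
  assumes "0 \<le> x"
  shows "x ^ n / fact n \<le> exp x"
proof -
  have "(\<Sum>i\<in>{n}. x ^ i /\<^sub>R fact i) \<le> (\<Sum>i. x ^ i /\<^sub>R fact i)"
    using assms by (intro sum_le_suminf summable_exp_generic) auto
  then show ?thesis
    by (simp add: exp_def field_simps)
qed

text \<open>The coefficient is at most \<open>(c * n) ^ n / fact n\<close>, and
  \<open>n ^ n / fact n\<close> is a single term of the series of \<open>exp n\<close>.\<close>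

lemma binomial_mult_le:
  assumes "n > 0"
  shows "real ((c * n) choose n) \<le> (exp 1 * real c) ^ n"
proof -
  have "real ((c * n) choose n) * fact n \<le> real ((c * n) ^ n)"
    using binomial_fact_pow[of "c * n" n] by (metis of_nat_fact of_nat_le_iff of_nat_mult)
  then have "real ((c * n) choose n) \<le> real c ^ n * (real n ^ n / fact n)"
    by (simp add: field_simps)
  also have "\<dots> \<le> real c ^ n * exp (real n)"
    by (intro mult_left_mono exp_ge_power_div_fact) auto
  also have "\<dots> = (exp 1 * real c) ^ n"
    by (simp add: power_mult_distrib exp_of_nat_mult[symmetric])
  finally show ?thesis .
qed

section \<open>Holes in the random bipartite graph\<close>

text \<open>Union bound over the pairs \<open>(S, T)\<close>: for a fixed pair, \<open>a * b\<close>
  independent coordinates must all be false, which has probability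
  \<open>(1 - p) ^ (a * b)\<close>.\<close>

lemma prob_hole_le:
  fixes p :: real
  assumes p: "0 \<le> p" "p \<le> 1"
  shows "measure_pmf.prob (Pi_pmf ({..<M} \<times> {..<N}) False (\<lambda>_. bernoulli_pmf p))
           {X. \<exists>S\<subseteq>{..<M}. \<exists>T\<subseteq>{..<N}. card S = a \<and> card T = b \<and> (\<forall>s\<in>S. \<forall>t\<in>T. \<not> X (s, t))}
         \<le> real (M choose a) * real (N choose b) * exp (- (p * real (a * b)))"
    (is "measure_pmf.prob ?Q ?bad \<le> _")
proof -
  define I where "I = {S. S \<subseteq> {..<M} \<and> card S = a} \<times> {T. T \<subseteq> {..<N} \<and> card T = b}"
  define hole where "hole = (\<lambda>(S, T). {X :: nat \<times> nat \<Rightarrow> bool. \<forall>s\<in>S. \<forall>t\<in>T. \<not> X (s, t)})"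
  have fin: "finite I"
    unfolding I_def by (intro finite_cartesian_product) auto
  have cardI: "card I = (M choose a) * (N choose b)"
    unfolding I_def by (simp add: card_cartesian_product n_subsets)
  have hole_le: "measure_pmf.prob ?Q (hole ST) \<le> exp (- (p * real (a * b)))" if "ST \<in> I" for ST
  proof -
    obtain S T where ST: "ST = (S, T)" "S \<subseteq> {..<M}" "card S = a" "T \<subseteq> {..<N}" "card T = b"
      using \<open>ST \<in> I\<close> by (auto simp: I_def)
    \<comment> \<open>\<open>B\<close> turns the event into a product of constraints on single
      coordinates, so its probability factorises; coordinates outside \<open>S \<times> T\<close>
      are free and contribute the factor 1.\<close>
    define B where "B ij = (if ij \<in> S \<times> T then {False} else UNIV)" for ij :: "nat \<times> nat"
    have "hole ST = Pi ({..<M} \<times> {..<N}) B"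
      using ST by (fastforce simp: hole_def B_def Pi_def)
    then have "measure_pmf.prob ?Q (hole ST)
        = (\<Prod>ij\<in>{..<M} \<times> {..<N}. measure_pmf.prob (bernoulli_pmf p) (B ij))"
      by (simp add: measure_Pi_pmf_Pi)
    also have "\<dots> = (\<Prod>ij\<in>{..<M} \<times> {..<N}. if ij \<in> S \<times> T then 1 - p else 1)"
      using p by (intro prod.cong refl) (simp add: B_def measure_pmf_single)
    also have "\<dots> = (\<Prod>ij\<in>S \<times> T. 1 - p)"
      using ST by (intro prod.mono_neutral_cong_right) auto
    also have "\<dots> = (1 - p) ^ (a * b)"
      using ST by (simp add: card_cartesian_product)
    also have "\<dots> \<le> exp (- p) ^ (a * b)"
      using p exp_ge_add_one_self[of "- p"] by (intro power_mono) auto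
    also have "\<dots> = exp (- (p * real (a * b)))"
      by (simp add: exp_of_nat_mult[symmetric] algebra_simps)
    finally show ?thesis .
  qed
  have "measure_pmf.prob ?Q ?bad \<le> measure_pmf.prob ?Q (\<Union>ST\<in>I. hole ST)"
  proof (rule measure_pmf.finite_measure_mono)
    show "?bad \<subseteq> (\<Union>ST\<in>I. hole ST)"
      unfolding I_def hole_def by blast
  qed simp
  also have "\<dots> \<le> (\<Sum>ST\<in>I. measure_pmf.prob ?Q (hole ST))"
    using fin by (intro measure_pmf.finite_measure_subadditive_finite) auto
  also have "\<dots> \<le> (\<Sum>ST\<in>I. exp (- (p * real (a * b))))"
    by (intro sum_mono hole_le)
  also have "\<dots> = real (M choose a) * real (N choose b) * exp (- (p * real (a * b)))"
    using cardI by simp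
  finally show ?thesis .
qed

text \<open>Applying \<open>ramsey_arrow_path_if_no_hole\<close> to each outcome places the failure
  event inside the event bounded by \<open>prob_hole_le\<close>.\<close>

lemma not_ramsey_arrow_random_bipartite_le:
  fixes p :: real
  assumes p: "0 \<le> p" "p \<le> 1" and M: "M = 2 ^ (r + 1) * n"
  shows "measure_pmf.prob (random_bipartite M M p) {G. \<not> ramsey_arrow G (path_graph n) r}
         \<le> real (M choose n) * real (M choose n) * exp (- (p * real (n * n)))"
proof -
  define Q where "Q = Pi_pmf ({..<M} \<times> {..<M}) False (\<lambda>_. bernoulli_pmf p)"
  define H where "H X = \<lparr>verts = {..<M + M}, edges = {{i, M + j} |i j. i < M \<and> j < M \<and> X (i, j)}\<rparr>"
    for X
  have "\<exists>S\<subseteq>{..<M}. \<exists>T\<subseteq>{..<M}. card S = n \<and> card T = n \<and> (\<forall>s\<in>S. \<forall>t\<in>T. \<not> X (s, t))"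
    if X: "\<not> ramsey_arrow (H X) (path_graph n) r" for X
  proof (rule ccontr)
    assume hole: "\<not> ?thesis"
    have "ramsey_arrow (H X) (path_graph n) r"
    proof (rule ramsey_arrow_path_if_no_hole[of "{..<M}" "{M..<M + M}"])
      fix S T assume ST: "S \<subseteq> {..<M}" "T \<subseteq> {M..<M + M}" "card S = n" "card T = n"
      \<comment> \<open>Vertices of the second part are \<open>M + j\<close> while the coordinates
        of \<open>X\<close> use \<open>j\<close>, so \<open>T\<close> is shifted down; this is
        injective because its elements are at least \<open>M\<close>.\<close>
      define T' where "T' = (\<lambda>t. t - M) ` T"
      have "inj_on (\<lambda>t. t - M) T"
        using ST(2) by (intro inj_on_diff_nat) auto
      then have "card T' = n"
        using ST(4) by (simp add: T'_def card_image)
      moreover have "T' \<subseteq> {..<M}"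
        using ST(2) by (force simp: T'_def)
      ultimately obtain s t' where st: "s \<in> S" "t' \<in> T'" "X (s, t')"
        using hole ST(1,3) by blast
      then obtain t where t: "t \<in> T" "t' = t - M"
        unfolding T'_def by blast
      then have "t = M + t'" "t' < M" "s < M"
        using ST(1,2) st(1) by force+
      then have "{s, t} \<in> edges (H X)"
        using st(3) unfolding H_def by auto
      then show "\<exists>s\<in>S. \<exists>t\<in>T. {s, t} \<in> edges (H X)"
        using st t by blast
    qed (auto simp: H_def M)
    with X show False
      by simp
  qed
  then have "measure_pmf.prob Q (H -` {G. \<not> ramsey_arrow G (path_graph n) r})
      \<le> measure_pmf.prob Q {X. \<exists>S\<subseteq>{..<M}. \<exists>T\<subseteq>{..<M}. card S = n \<and> card T = n \<and>
          (\<forall>s\<in>S. \<forall>t\<in>T. \<not> X (s, t))}"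
    by (intro measure_pmf.finite_measure_mono) auto
  also have "\<dots> \<le> real (M choose n) * real (M choose n) * exp (- (p * real (n * n)))"
    unfolding Q_def by (rule prob_hole_le[OF p])
  finally show ?thesis
    by (simp add: random_bipartite_def Q_def H_def[abs_def])
qed

section \<open>The number of edges of the random graph\<close>

lemma simple_graph_random_bipartite:
  assumes "G \<in> set_pmf (random_bipartite M N p)"
  shows "simple_graph G"
proof -
  obtain X :: "nat \<times> nat \<Rightarrow> bool" where
    "G = \<lparr>verts = {..<M + N}, edges = {{i, M + j} |i j. i < M \<and> j < N \<and> X (i, j)}\<rparr>"
    using assms unfolding random_bipartite_def set_map_pmf by blast
  then show ?thesis
    by (auto simp: simple_graph_def)
qed

text \<open>Markov's inequality for the number of true coordinates, whose mean is
  \<open>M * N * p\<close> by linearity and which is at least the number of edges.\<close>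

lemma prob_many_edges_random_bipartite_le:
  fixes p :: real
  assumes p: "0 \<le> p" "p \<le> 1" and "0 < a"
  shows "measure_pmf.prob (random_bipartite M N p) {G. a \<le> real (card (edges G))}
         \<le> real (M * N) * p / a"
proof -
  define I where "I = {..<M} \<times> {..<N}"
  define Q where "Q = Pi_pmf I False (\<lambda>_. bernoulli_pmf p)"
  define cnt where "cnt X = (\<Sum>ij\<in>I. of_bool (X ij) :: real)" for X
  have finI: "finite I"
    by (simp add: I_def)
  have card_le: "real (card {{i, M + j} |i j. i < M \<and> j < N \<and> X (i, j)}) \<le> cnt X" for X
  proof -
    have "{{i, M + j} |i j. i < M \<and> j < N \<and> X (i, j)} = (\<lambda>(i, j). {i, M + j}) ` {ij \<in> I. X ij}"
      by (auto simp: I_def)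
    then have "card {{i, M + j} |i j. i < M \<and> j < N \<and> X (i, j)} \<le> card {ij \<in> I. X ij}"
      using finI by (simp add: card_image_le)
    also have "real (card {ij \<in> I. X ij}) = cnt X"
      using finI by (simp add: cnt_def of_bool_def sum.If_cases Int_def conj_commute)
    finally show ?thesis
      by simp
  qed
  have int: "integrable (measure_pmf Q) (\<lambda>X. of_bool (X ij) :: real)" for ij
    by (rule measure_pmf.integrable_const_bound[of _ 1]) auto
  have "measure_pmf.expectation Q (\<lambda>X. of_bool (X ij)) = p" if "ij \<in> I" for ij
  proof -
    have "measure_pmf.expectation Q (\<lambda>X. of_bool (X ij))
        = measure_pmf.expectation (map_pmf (\<lambda>X. X ij) Q) (of_bool :: bool \<Rightarrow> real)"
      by simp
    also have "map_pmf (\<lambda>X. X ij) Q = bernoulli_pmf p"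
      using that finI by (simp add: Q_def Pi_pmf_component)
    also have "measure_pmf.expectation (bernoulli_pmf p) of_bool = p"
      using p by simp
    finally show ?thesis .
  qed
  then have exp_cnt: "measure_pmf.expectation Q cnt = real (M * N) * p"
    unfolding cnt_def[abs_def] using int
    by (simp add: Bochner_Integration.integral_sum I_def del: sum_of_bool_eq)
  have "measure_pmf.prob (random_bipartite M N p) {G. a \<le> real (card (edges G))}
      = measure_pmf.prob Q {X. a \<le> real (card {{i, M + j} |i j. i < M \<and> j < N \<and> X (i, j)})}"
    by (simp add: random_bipartite_def Q_def I_def vimage_def)
  also have "\<dots> \<le> measure_pmf.prob Q {X. a \<le> cnt X}"
    by (intro measure_pmf.finite_measure_mono) (auto intro: order_trans[OF _ card_le])
  also have "\<dots> \<le> measure_pmf.expectation Q cnt / a"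
  proof -
    have "integrable Q cnt"
      unfolding cnt_def[abs_def] using int by simp
    then show ?thesis
      using integral_Markov_inequality_measure[of Q cnt UNIV a] \<open>0 < a\<close>
      by (simp add: cnt_def sum_nonneg del: sum_of_bool_eq flip: cnt_def[abs_def])
  qed
  finally show ?thesis
    by (simp add: exp_cnt)
qed

section \<open>Choice of constants and conclusion\<close>

theorem theorem3p8:
  fixes r c d :: nat
  assumes "r \<ge> 2" and "c = 2 ^ (r + 1)" and "d = 8 * r"
  shows "((\<lambda>n. measure_pmf.prob (random_bipartite (c * n) (c * n) (real d / real n))
              {G. ramsey_arrow G (path_graph n) r}) \<longlonglongrightarrow> 1) \<and>
         (\<forall>\<^sub>F n in sequentially. size_ramsey (path_graph n) r < enat (33 * r * 4 ^ r * n))"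
proof -
  define RG where "RG n = random_bipartite (c * n) (c * n) (real d / real n)" for n
  define bad where "bad n = measure_pmf.prob (RG n) {G. \<not> ramsey_arrow G (path_graph n) r}" for n
  \<comment> \<open>\<open>q ^ n\<close> will bound the failure probability: the square comes from
    the two binomial coefficients, the exponential from
    \<open>d / n * (n * n) = d * n\<close>.\<close>
  define q where "q = (exp 1 * real c)\<^sup>2 * exp (- real d)"
  \<comment> \<open>\<open>d / n\<close> is a probability only for \<open>n \<ge> d\<close>; both
    claims are asymptotic, so restricting to such \<open>n\<close> is harmless.\<close>
  have p: "0 \<le> real d / real n" "real d / real n \<le> 1" "n > 0" if "n \<ge> max 1 d" for n
    using that by auto
  have q: "0 \<le> q" "q < 1"
  proof -
    \<comment> \<open>From \<open>2 \<le> exp 1\<close> follows \<open>c \<le> exp (1 + r)\<close>,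
      hence \<open>q \<le> exp (4 + 2 * r - 8 * r)\<close>, whose exponent is negative.\<close>
    have "real c = 2 * 2 ^ r"
      using assms by simp
    also have "\<dots> \<le> exp 1 * exp 1 ^ r"
      using exp_ge_add_one_self[of 1] by (intro mult_mono power_mono) auto
    also have "\<dots> = exp (1 + real r)"
      by (simp add: exp_add exp_of_nat_mult[symmetric])
    finally have "(exp 1 * real c)\<^sup>2 \<le> (exp 1 * exp (1 + real r))\<^sup>2"
      by (intro power_mono mult_left_mono) auto
    then have "q \<le> (exp 1 * exp (1 + real r))\<^sup>2 * exp (- real d)"
      unfolding q_def by (intro mult_right_mono) auto
    also have "\<dots> = exp (4 + 2 * real r - real d)"
      by (simp add: power2_eq_square exp_add[symmetric] exp_diff exp_minus field_simps)
    also have "\<dots> < 1"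
      using assms by simp
    finally show "q < 1" .
  qed (simp add: q_def)
  have bad_le: "bad n \<le> q ^ n" if "n \<ge> max 1 d" for n
  proof -
    have "bad n \<le> real ((c * n) choose n) * real ((c * n) choose n)
        * exp (- (real d / real n * real (n * n)))"
      unfolding bad_def RG_def
      by (rule not_ramsey_arrow_random_bipartite_le) (use p[OF that] assms in auto)
    also have "\<dots> \<le> (exp 1 * real c) ^ n * (exp 1 * real c) ^ n
        * exp (- (real d / real n * real (n * n)))"
      using binomial_mult_le[OF p(3)[OF that], of c] by (intro mult_right_mono mult_mono) auto
    also have "exp (- (real d / real n * real (n * n))) = exp (- real d) ^ n"
      using p(3)[OF that] by (simp add: exp_of_nat_mult[symmetric] mult.commute)
    also have "(exp 1 * real c) ^ n * (exp 1 * real c) ^ n * exp (- real d) ^ n = q ^ n"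
      by (simp add: q_def power2_eq_square power_mult_distrib)
    finally show ?thesis .
  qed
  have qn: "(\<lambda>n. q ^ n) \<longlonglongrightarrow> 0"
    using q by (simp add: LIMSEQ_realpow_zero)
  have bad_0: "bad \<longlonglongrightarrow> 0"
  proof (rule tendsto_sandwich[OF _ _ tendsto_const qn])
    show "\<forall>\<^sub>F n in sequentially. bad n \<le> q ^ n"
      using bad_le by (rule eventually_sequentiallyI)
  qed (simp add: bad_def)
  have good: "measure_pmf.prob (RG n) {G. ramsey_arrow G (path_graph n) r} = 1 - bad n" for n
    using measure_pmf.prob_compl[of "{G. \<not> ramsey_arrow G (path_graph n) r}" "RG n"]
    by (simp add: bad_def Compl_eq_Diff_UNIV[symmetric] Collect_neg_eq)
  have "(\<lambda>n. measure_pmf.prob (RG n) {G. ramsey_arrow G (path_graph n) r}) \<longlonglongrightarrow> 1"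
    using tendsto_diff[OF tendsto_const bad_0, of 1] by (simp add: good)
  moreover have "\<forall>\<^sub>F n in sequentially. bad n < 1 / 33"
    using bad_0 by (rule order_tendstoD) simp
  then have "\<forall>\<^sub>F n in sequentially. size_ramsey (path_graph n) r < enat (33 * r * 4 ^ r * n)"
    using eventually_ge_at_top[of "max 1 d"]
  proof eventually_elim
    case (elim n)
    define m where "m = 33 * r * 4 ^ r * n"
    have m: "0 < m"
      using assms p[OF elim(2)] by (simp add: m_def)
    have "measure_pmf.prob (RG n) {G. real m \<le> real (card (edges G))}
        \<le> real (c * n * (c * n)) * (real d / real n) / real m"
      unfolding RG_def using p[OF elim(2)] m
      by (intro prob_many_edges_random_bipartite_le) auto
    also have "\<dots> = 32 / 33"
    proof -
      \<comment> \<open>The mean is \<open>c * c * d * n = 32 * r * 4 ^ r * n\<close>, which is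
        \<open>32 / 33\<close> of \<open>m\<close>.\<close>
      have "c * c = 4 * 4 ^ r"
        by (simp add: assms power_mult_distrib[symmetric])
      then have "real c * real c = 4 * 4 ^ r"
        by (metis of_nat_mult of_nat_numeral of_nat_power)
      then have "real (c * n * (c * n)) * (real d / real n) = 32 * real r * 4 ^ r * real n"
        using p[OF elim(2)] assms(3) by (simp add: field_simps)
      then show ?thesis
        using m by (simp add: m_def field_simps)
    qed
    finally have "measure_pmf.prob (RG n) ({G. real m \<le> real (card (edges G))} \<union>
        {G. \<not> ramsey_arrow G (path_graph n) r}) \<le> 32 / 33 + bad n"
      unfolding bad_def
      by (intro order_trans[OF measure_Un_le]) auto
    also have "\<dots> < 1"
      using elim by simp
    \<comment> \<open>An event containing the support has probability 1, so some graph in the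
      support avoids both events.\<close>
    finally have "\<not> set_pmf (RG n) \<subseteq> {G. real m \<le> real (card (edges G))} \<union>
        {G. \<not> ramsey_arrow G (path_graph n) r}"
      by (metis less_irrefl measure_pmf.prob_eq_1 AE_measure_pmf_iff subsetD UNIV_I sets_measure_pmf)
    then obtain G where G: "G \<in> set_pmf (RG n)" "card (edges G) < m"
      "ramsey_arrow G (path_graph n) r"
      by (auto simp: not_le)
    then have "size_ramsey (path_graph n) r \<le> enat (card (edges G))"
      unfolding size_ramsey_def RG_def
      by (intro Inf_lower) (auto intro: simple_graph_random_bipartite)
    then show ?case
      using G(2) by (metis enat_ord_simps(2) m_def order_le_less_trans)
  qed
  ultimately show ?thesis
    unfolding RG_def by blast
qed

end
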